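(* Let $F$ be a distribution function on $[0,\infty)$ with $F(0)=0$, let $\alpha>0$ and $\theta>\alpha$, and assume $m(\alpha)<\infty$. Then the following statements are equivalent (all limits are as $x\to\infty$): (a) $\overline{F}(x)\in RV_{-\theta}$; (b) $\overline{W}_\alpha(x)\in RV_{\alpha-\theta}$; (c) $x^{-\alpha}m(\alpha)-\overline{G}_\alpha(x)\in RV_{-\theta}$; (d) $\overline{W}_\alpha(x)/(x^\alpha\overline{F}(x))\to 1/(\theta-\alpha)$; (e) $(x^{-\alpha}m(\alpha)-\overline{G}_\alpha(x))/\overline{F}(x)\to\alpha/(\theta-\alpha)$; (f) $m(\alpha)-H_\alpha(x)\in RV_{\alpha-\theta}$; (g) $(m(\alpha)-H_\alpha(x))/(x^\alpha\overline{F}(x))\to\theta/(\theta-\alpha)$.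
   Context: For a distribution function $F$ on $[0,\infty)$ with $F(0)=0$, write $\overline{F}(x)=1-F(x)$, and let $m(\alpha)=\int_{[0,\infty)}y^\alpha\,dF(y)$ be its $\alpha$-th moment. For $\alpha>0$ and $x>0$ define $H_\alpha(x)=\int_{[0,x]}y^\alpha\,dF(y)$, $W_\alpha(x)=\int_0^x y^{\alpha-1}\overline{F}(y)\,dy$, $W_\alpha(\infty)=\lim_{x\to\infty}W_\alpha(x)$, $\overline{W}_\alpha(x)=W_\alpha(\infty)-W_\alpha(x)$, and the Williamson transform $G_\alpha(x)=\int_{[0,x]}\left(1-(t/x)^\alpha\right)dF(t)$, with $\overline{G}_\alpha(x)=1-G_\alpha(x)$. For $\rho\in\mathbb{R}$, $RV_\rho$ is the class of regularly varying functions of index $\rho$: $f\in RV_\rho$ if for every $t>0$, $f(tx)/(t^\rho f(x))\to1$ as $x\to\infty$. Ratios in (d), (e), (g) are required to be defined (i.e. $\overline{F}(x)>0$) for all large $x$. *)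

theory Defs
  imports "HOL-Analysis.Analysis"
begin

text \<open>A distribution function on \<open>[0,\<infinity>)\<close> is extended by \<open>0\<close> to the negative reals, so that
  integration with respect to \<open>dF\<close> is integration with respect to \<^term>\<open>interval_measure F\<close>,
  whose value on \<open>{a<..b}\<close> is \<open>F b - F a\<close>.  (For a function \<open>F\<close> that is not monotone and
  right-continuous, \<^term>\<open>interval_measure F\<close> need not have this property.)\<close>

definition distribution_function_nonneg :: "(real \<Rightarrow> real) \<Rightarrow> bool" where
  "distribution_function_nonneg F \<longleftrightarrow>
     mono F \<and> (\<forall>x. continuous (at_right x) F) \<and> (\<forall>x<0. F x = 0) \<and> (F \<longlongrightarrow> 1) at_top"

definition tail :: "(real \<Rightarrow> real) \<Rightarrow> real \<Rightarrow> real" where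
  "tail F x = 1 - F x"

text \<open>The moment is an extended nonnegative real, so that its finiteness is a genuine condition.\<close>

definition moment :: "(real \<Rightarrow> real) \<Rightarrow> real \<Rightarrow> ennreal" where
  "moment F \<alpha> = (\<integral>\<^sup>+y\<in>{0..}. ennreal (y powr \<alpha>) \<partial>interval_measure F)"

definition H :: "(real \<Rightarrow> real) \<Rightarrow> real \<Rightarrow> real \<Rightarrow> real" where
  "H F \<alpha> x = (LINT y:{0..x}|interval_measure F. y powr \<alpha>)"

text \<open>For \<open>\<alpha> < 1\<close> the integrand is unbounded near \<open>0\<close>, but it is dominated by the
  integrable function \<open>y powr (\<alpha> - 1)\<close>; its value at \<open>0\<close> is irrelevant.\<close>

definition W :: "(real \<Rightarrow> real) \<Rightarrow> real \<Rightarrow> real \<Rightarrow> real" where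
  "W F \<alpha> x = (LINT y:{0..x}|lborel. y powr (\<alpha> - 1) * tail F y)"

text \<open>The limit is finite when the \<open>\<alpha>\<close>-th moment is; otherwise the value is unspecified.\<close>

definition W_infinity :: "(real \<Rightarrow> real) \<Rightarrow> real \<Rightarrow> real" where
  "W_infinity F \<alpha> = Lim at_top (W F \<alpha>)"

definition W_bar :: "(real \<Rightarrow> real) \<Rightarrow> real \<Rightarrow> real \<Rightarrow> real" where
  "W_bar F \<alpha> x = W_infinity F \<alpha> - W F \<alpha> x"

definition G :: "(real \<Rightarrow> real) \<Rightarrow> real \<Rightarrow> real \<Rightarrow> real" where
  "G F \<alpha> x = (LINT t:{0..x}|interval_measure F. 1 - (t / x) powr \<alpha>)"

definition G_bar :: "(real \<Rightarrow> real) \<Rightarrow> real \<Rightarrow> real \<Rightarrow> real" where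
  "G_bar F \<alpha> x = 1 - G F \<alpha> x"

text \<open>Since division by \<open>0\<close> yields \<open>0\<close>, the limit \<open>1\<close> forces \<open>f x \<noteq> 0\<close> for all large \<open>x\<close>.\<close>

definition RV :: "real \<Rightarrow> (real \<Rightarrow> real) set" where
  "RV \<rho> = {f. \<forall>t>0. ((\<lambda>x. f (t * x) / (t powr \<rho> * f x)) \<longlongrightarrow> 1) at_top}"

end

(* Karamata's theorem and the monotone density theorem relate a nonincreasing h to
   K x = int_x^infinity y^(b-1) h(y) dy: for rho <> 0, h in RV_(-rho-b), K in RV_(-rho) and
   K(x)/(x^b h(x)) -> 1/rho (with h eventually positive) are equivalent. Apply this twice: to
   h = tail F with b = alpha, rho = theta - alpha, where K = W_bar, and to h = m - H with
   b = -alpha, rho = theta, where K x = x^(-alpha) W_bar x. The remaining statements are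
   reformulations, by the identities m - H x = alpha W_bar x + x^alpha tail x and
   x^(-alpha) m - G_bar x = alpha x^(-alpha) W_bar x.

   The only property of K that matters is that its increments lie between the lower and upper
   sums h(z) (z^b - x^b)/b and h(x) (z^b - x^b)/b. Refining the partition turns such a squeeze
   into uniqueness and comparison statements for K, and, when x^b h(x)/K(x) -> rho, into the
   eventual monotonicity of x^c K(x) for every c <> rho. *)

theory Submission
  imports Defs
begin

section \<open>Regular variation and multiplication by powers\<close>

text \<open>The quotient for \<open>f\<close> factors into \<open>?r (t * x) / ?r x\<close> and the
  quotient for \<open>g\<close>. The first factor tends to \<open>c / c\<close>, which is where
  \<open>c \<noteq> 0\<close> enters.\<close>

lemma RV_asymp:
  assumes g: "g \<in> RV \<rho>" and c: "c \<noteq> 0"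
    and lim: "((\<lambda>x. f x / (x powr \<sigma> * g x)) \<longlongrightarrow> c) at_top"
  shows "f \<in> RV (\<rho> + \<sigma>)"
  unfolding RV_def
proof (intro CollectI allI impI)
  fix t :: real assume t: "t > 0"
  let ?r = "\<lambda>x. f x / (x powr \<sigma> * g x)"
  have tx: "filterlim (\<lambda>x::real. t * x) at_top at_top"
    by (rule filterlim_tendsto_pos_mult_at_top[OF tendsto_const t filterlim_ident])
  have nz: "\<forall>\<^sub>F x in at_top. ?r x \<noteq> 0"
    using lim c by (rule tendsto_imp_eventually_ne)
  have "((\<lambda>x. ?r (t * x) / ?r x * (g (t * x) / (t powr \<rho> * g x))) \<longlongrightarrow> c / c * 1) at_top"
    using g t by (intro tendsto_intros filterlim_compose[OF lim tx] lim c) (auto simp: RV_def)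
  \<comment> \<open>Division by 0 gives 0, so \<open>?r\<close> being nonzero at \<open>x\<close>
    and \<open>t * x\<close> makes \<open>f\<close> and \<open>g\<close> nonzero at both points and
    permits the cancellation.\<close>
  moreover have "\<forall>\<^sub>F x in at_top. ?r (t * x) / ?r x * (g (t * x) / (t powr \<rho> * g x))
      = f (t * x) / (t powr (\<rho> + \<sigma>) * f x)"
    using nz eventually_compose_filterlim[OF nz tx] eventually_gt_at_top[of 0]
  proof eventually_elim
    case (elim x)
    then show ?case using t
      by (simp add: powr_add powr_mult field_simps)
  qed
  ultimately show "((\<lambda>x. f (t * x) / (t powr (\<rho> + \<sigma>) * f x)) \<longlongrightarrow> 1) at_top"
    using c by (simp add: filterlim_cong)
qed

text \<open>The case \<open>t = 1\<close> of the definition: the quotient is 0 wherever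
  \<open>f x = 0\<close>, which the limit 1 excludes for large \<open>x\<close>.\<close>

lemma RV_eventually_nonzero:
  assumes "f \<in> RV \<rho>"
  shows "\<forall>\<^sub>F x in at_top. f x \<noteq> 0"
proof -
  have "((\<lambda>x. f (1 * x) / (1 powr \<rho> * f x)) \<longlongrightarrow> 1) at_top"
    using assms unfolding RV_def by (blast intro: zero_less_one)
  then have "\<forall>\<^sub>F x in at_top. f (1 * x) / (1 powr \<rho> * f x) \<noteq> 0"
    by (rule tendsto_imp_eventually_ne) simp
  then show ?thesis
    by eventually_elim auto
qed

text \<open>Apply \<open>RV_asymp\<close> with exponent \<open>\<sigma>\<close> in one direction and
  \<open>- \<sigma>\<close> in the other; both ratios are eventually constant.\<close>

lemma RV_shift_iff:
  assumes "c \<noteq> 0" and eq: "\<And>x. x > 0 \<Longrightarrow> f x = c * x powr \<sigma> * g x"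
  shows "f \<in> RV (\<rho> + \<sigma>) \<longleftrightarrow> g \<in> RV \<rho>"
proof
  assume g: "g \<in> RV \<rho>"
  have "\<forall>\<^sub>F x in at_top. f x / (x powr \<sigma> * g x) = c"
    using RV_eventually_nonzero[OF g] eventually_gt_at_top[of 0]
    by eventually_elim (simp add: eq)
  then have "((\<lambda>x. f x / (x powr \<sigma> * g x)) \<longlongrightarrow> c) at_top"
    by (rule tendsto_eventually)
  with g assms(1) show "f \<in> RV (\<rho> + \<sigma>)"
    by (intro RV_asymp)
next
  assume f: "f \<in> RV (\<rho> + \<sigma>)"
  have "\<forall>\<^sub>F x in at_top. g x / (x powr - \<sigma> * f x) = 1 / c"
    using RV_eventually_nonzero[OF f] eventually_gt_at_top[of 0]
    by eventually_elim (auto simp: eq powr_minus field_simps)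
  then have "((\<lambda>x. g x / (x powr - \<sigma> * f x)) \<longlongrightarrow> 1 / c) at_top"
    by (rule tendsto_eventually)
  then have "g \<in> RV (\<rho> + \<sigma> + - \<sigma>)"
    using assms(1) by (intro RV_asymp[OF f, of "1 / c"]) auto
  then show "g \<in> RV \<rho>"
    by simp
qed

section \<open>From short intervals to long ones\<close>

text \<open>The increments of \<open>K - L\<close> are at most upper minus lower sum,
  \<open>(h u - h v) * (p v - p u)\<close>. On pieces where \<open>p\<close> varies by at most
  \<open>\<epsilon>\<close> these bounds telescope to \<open>\<epsilon> * (h x - h z)\<close>, and
  \<open>\<epsilon>\<close> is arbitrary.\<close>

lemma increment_comparison:
  fixes h p K L :: "real \<Rightarrow> real"
  assumes "x \<le> z"
    and cont: "continuous_on {x..z} p"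
    and anti: "\<And>u v. x \<le> u \<Longrightarrow> u \<le> v \<Longrightarrow> h v \<le> h u"
    and K: "\<And>u v. x \<le> u \<Longrightarrow> u \<le> v \<Longrightarrow> K u - K v \<le> h u * (p v - p u)"
    and L: "\<And>u v. x \<le> u \<Longrightarrow> u \<le> v \<Longrightarrow> h v * (p v - p u) \<le> L u - L v"
  shows "K x - K z \<le> L x - L z"
proof -
  define D where "D u = K u - L u" for u
  have D: "D u - D v \<le> (h u - h v) * (p v - p u)" if "x \<le> u" "u \<le> v" for u v
    using K[OF that] L[OF that] by (simp add: D_def algebra_simps)
  have small: "D x - D z \<le> \<epsilon> * (h x - h z)" if "\<epsilon> > 0" for \<epsilon>
  proof -
    \<comment> \<open>\<open>Bolzano\<close> replaces \<open>x\<close> and \<open>z\<close> by the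
      ends of subintervals, and its local case also offers intervals sticking out of the original
      one. The copies \<open>lo\<close> and \<open>hi\<close> keep the original ends, so that such
      intervals can be excluded.\<close>
    define lo hi where lo: "lo = x" and hi: "hi = z"
    have "lo \<le> x \<and> z \<le> hi \<longrightarrow> D x - D z \<le> \<epsilon> * (h x - h z)"
      using \<open>x \<le> z\<close>
    proof (induction rule: Bolzano)
      case (trans u v w)
      then show ?case
        by (auto simp: algebra_simps)
    next
      case (local y)
      then obtain d where d: "d > 0" "\<And>w. x \<le> w \<Longrightarrow> w \<le> z \<Longrightarrow> \<bar>w - y\<bar> < d \<Longrightarrow> \<bar>p w - p y\<bar> < \<epsilon> / 2"
        using cont \<open>\<epsilon> > 0\<close> unfolding continuous_on_iff dist_real_def
        by (metis atLeastAtMost_iff half_gt_zero)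
      show ?case
      proof (intro exI[of _ d] conjI allI impI d(1))
        fix u v assume uv: "u \<le> y \<and> y \<le> v \<and> v - u < d" and "lo \<le> u \<and> v \<le> hi"
        then have xuvz: "x \<le> u \<and> v \<le> z" by (simp add: lo hi)
        with uv have "\<bar>p u - p y\<bar> < \<epsilon> / 2" "\<bar>p v - p y\<bar> < \<epsilon> / 2"
          using local(1,2) by (auto intro!: d(2) simp del: less_divide_eq_numeral1)
        then have "p v - p u \<le> \<epsilon>"
          by arith
        then have "(h u - h v) * (p v - p u) \<le> (h u - h v) * \<epsilon>"
          using anti[of u v] uv xuvz by (intro mult_left_mono) auto
        then show "D u - D v \<le> \<epsilon> * (h u - h v)"
          using D[of u v] uv xuvz by (simp add: mult.commute)
      qed
    qed
    then show ?thesis by (simp add: lo hi)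
  qed
  have "((\<lambda>\<epsilon>. \<epsilon> * (h x - h z)) \<longlongrightarrow> 0 * (h x - h z)) (at_right 0)"
    by (intro tendsto_intros)
  moreover have "\<forall>\<^sub>F \<epsilon> in at_right (0::real). D x - D z \<le> \<epsilon> * (h x - h z)"
    using eventually_at_right_less[of "0::real"] by eventually_elim (rule small)
  ultimately have "D x - D z \<le> 0"
    using tendsto_lowerbound[of "\<lambda>\<epsilon>. \<epsilon> * (h x - h z)" "0 * (h x - h z)" "at_right 0" "D x - D z"] by simp
  then show ?thesis by (simp add: D_def)
qed

text \<open>Above \<open>N\<close> the multiplicative window \<open>(1 + \<delta>) * u\<close>
  contains the additive window of fixed width \<open>\<delta> * N\<close>, so finitely many short
  steps lead from \<open>x\<close> to \<open>z\<close>.\<close>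

lemma antimono_if_locally_antimono:
  fixes f :: "real \<Rightarrow> real"
  assumes "N > 0" "\<delta> > 0"
    and loc: "\<And>u v. N \<le> u \<Longrightarrow> u \<le> v \<Longrightarrow> v < (1 + \<delta>) * u \<Longrightarrow> f v \<le> f u"
    and "N \<le> x" "x \<le> z"
  shows "f z \<le> f x"
proof -
  have "N \<le> x \<longrightarrow> f z \<le> f x"
    using \<open>x \<le> z\<close>
  proof (induction rule: Bolzano)
    case (local y)
    show ?case
    proof (intro exI[of _ "\<delta> * N"] conjI allI impI)
      fix u v assume uv: "u \<le> y \<and> y \<le> v \<and> v - u < \<delta> * N" and "N \<le> u"
      have "\<delta> * N \<le> \<delta> * u"
        using \<open>N \<le> u\<close> assms(2) by simp
      with uv show "f v \<le> f u"
        using \<open>N \<le> u\<close> by (intro loc) (auto simp: algebra_simps)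
    qed (use assms in simp)
  qed auto
  then show ?thesis using \<open>N \<le> x\<close> by simp
qed

section \<open>Karamata theory for a monotone density\<close>

text \<open>The axioms say that \<open>K x\<close> is the integral of \<open>y powr (\<beta> - 1) * h y\<close> over \<open>y > x\<close>,
  expressed without integrals.\<close>

locale tail_integral =
  fixes h K :: "real \<Rightarrow> real" and \<beta> :: real
  assumes beta: "\<beta> \<noteq> 0"
    and nonneg: "0 < x \<Longrightarrow> 0 \<le> h x"
    and antimono: "0 < x \<Longrightarrow> x \<le> z \<Longrightarrow> h z \<le> h x"
    and lower: "0 < x \<Longrightarrow> x \<le> z \<Longrightarrow> h z * (z powr \<beta> / \<beta> - x powr \<beta> / \<beta>) \<le> K x - K z"
    and upper: "0 < x \<Longrightarrow> x \<le> z \<Longrightarrow> K x - K z \<le> h x * (z powr \<beta> / \<beta> - x powr \<beta> / \<beta>)"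
    and lim: "(K \<longlongrightarrow> 0) at_top"
begin

text \<open>Dividing by \<open>\<beta>\<close> corrects the sign, so that positive and negative
  exponents can be treated alike.\<close>

lemma weight_mono:
  assumes "0 < x" "x \<le> z"
  shows "x powr \<beta> / \<beta> \<le> z powr \<beta> / \<beta>"
proof (cases "\<beta> > 0")
  case True
  with assms show ?thesis by (simp add: divide_right_mono powr_mono2)
next
  case False
  with assms beta have "z powr \<beta> \<le> x powr \<beta>" by (intro powr_mono2') auto
  with False show ?thesis by (simp add: divide_right_mono_neg)
qed

lemma weight_strict:
  assumes "0 < x" "x < z"
  shows "x powr \<beta> / \<beta> < z powr \<beta> / \<beta>"
proof (cases "\<beta> > 0")
  case True
  with assms show ?thesis by (simp add: divide_strict_right_mono powr_less_mono2)
next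
  case False
  with assms beta have "z powr \<beta> < x powr \<beta>" by (intro powr_less_mono2_neg) auto
  with False beta show ?thesis by (simp add: divide_strict_right_mono_neg)
qed

lemma K_antimono:
  assumes "0 < x" "x \<le> z"
  shows "K z \<le> K x"
proof -
  have "0 \<le> h z * (z powr \<beta> / \<beta> - x powr \<beta> / \<beta>)"
    using assms nonneg[of z] weight_mono[OF assms] by (intro mult_nonneg_nonneg) auto
  then show ?thesis using lower[OF assms] by simp
qed

lemma K_nonneg:
  assumes "0 < x" shows "0 \<le> K x"
proof (rule tendsto_upperbound[OF lim])
  show "\<forall>\<^sub>F z in at_top. K z \<le> K x"
    using eventually_ge_at_top[of x] by eventually_elim (rule K_antimono[OF assms])
qed simp

text \<open>Monotonicity carries positivity back from a far point where \<open>K\<close> does not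
  vanish.\<close>

lemma K_pos:
  assumes "\<forall>\<^sub>F x in at_top. K x \<noteq> 0" and "0 < x"
  shows "0 < K x"
proof -
  have "\<forall>\<^sub>F z in at_top. K z \<noteq> 0 \<and> x \<le> z"
    using assms(1) eventually_ge_at_top by (rule eventually_conj)
  then obtain z where "K z \<noteq> 0" "x \<le> z"
    using eventually_happens trivial_limit_at_top_linorder by blast
  then show ?thesis
    using K_nonneg[of z] K_antimono[of x z] assms(2) by linarith
qed

lemma h_pos:
  assumes "\<forall>\<^sub>F x in at_top. h x \<noteq> 0" and "0 < x"
  shows "0 < h x"
proof -
  have "\<forall>\<^sub>F z in at_top. h z \<noteq> 0 \<and> x \<le> z"
    using assms(1) eventually_ge_at_top by (rule eventually_conj)
  then obtain z where "h z \<noteq> 0" "x \<le> z"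
    using eventually_happens trivial_limit_at_top_linorder by blast
  then show ?thesis
    using nonneg[of z] antimono[of x z] assms(2) by linarith
qed

lemma K_pos_of_h_pos:
  assumes "\<forall>\<^sub>F x in at_top. h x \<noteq> 0" and "0 < x"
  shows "0 < K x"
proof -
  have "0 < h (x + 1) * ((x + 1) powr \<beta> / \<beta> - x powr \<beta> / \<beta>)"
    using h_pos[OF assms(1), of "x + 1"] weight_strict[of x "x + 1"] assms(2) by simp
  then show ?thesis using lower[of x "x + 1"] K_nonneg[of "x + 1"] assms(2) by simp
qed

text \<open>This is the substitution of \<open>t * y\<close> for \<open>y\<close> in the integral.
  It makes \<open>K (t * x)\<close> and multiples of \<open>K x\<close> tail integrals of comparable
  densities.\<close>

lemma scale:
  assumes "0 \<le> c" "0 < t"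
  shows "tail_integral (\<lambda>y. c * t powr \<beta> * h (t * y)) (\<lambda>y. c * K (t * y)) \<beta>"
proof
  show "((\<lambda>y. c * K (t * y)) \<longlongrightarrow> 0) at_top"
    using filterlim_compose[OF lim filterlim_tendsto_pos_mult_at_top[OF tendsto_const assms(2) filterlim_ident]]
    by (rule tendsto_mult_right_zero)
next
  fix x z :: real assume xz: "0 < x" "x \<le> z"
  have "h (t * z) * ((t * z) powr \<beta> / \<beta> - (t * x) powr \<beta> / \<beta>) \<le> K (t * x) - K (t * z)"
    "K (t * x) - K (t * z) \<le> h (t * x) * ((t * z) powr \<beta> / \<beta> - (t * x) powr \<beta> / \<beta>)"
    using assms xz by (auto intro!: lower upper)
  note this[THEN mult_left_mono, OF assms(1)]
  then show "c * t powr \<beta> * h (t * z) * (z powr \<beta> / \<beta> - x powr \<beta> / \<beta>) \<le> c * K (t * x) - c * K (t * z)"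
    "c * K (t * x) - c * K (t * z) \<le> c * t powr \<beta> * h (t * x) * (z powr \<beta> / \<beta> - x powr \<beta> / \<beta>)"
    using assms xz by (simp_all add: powr_mult algebra_simps)
qed (use assms in \<open>auto intro!: mult_left_mono antimono nonneg beta mult_nonneg_nonneg\<close>)

end

text \<open>An upper sum for \<open>h\<close> is at most the one for \<open>h'\<close>, so
  \<open>increment_comparison\<close> orders the increments up to \<open>z\<close>; then
  \<open>z\<close> tends to infinity, where both functions vanish.\<close>

lemma tail_integral_le:
  assumes "tail_integral h K \<beta>" "tail_integral h' K' \<beta>" "0 < x"
    and le: "\<And>y. x \<le> y \<Longrightarrow> h y \<le> h' y"
  shows "K x \<le> K' x"
proof -
  interpret A: tail_integral h K \<beta> by fact
  interpret B: tail_integral h' K' \<beta> by fact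
  have *: "K x - K z \<le> K' x - K' z" if "x \<le> z" for z
  proof (rule increment_comparison[OF that, where p = "\<lambda>y. y powr \<beta> / \<beta>" and h = h'])
    show "continuous_on {x..z} (\<lambda>y. y powr \<beta> / \<beta>)"
      using \<open>0 < x\<close> A.beta by (intro continuous_intros) auto
  next
    fix u v assume uv: "x \<le> u" "u \<le> v"
    show "h' v \<le> h' u" "h' v * (v powr \<beta> / \<beta> - u powr \<beta> / \<beta>) \<le> K' u - K' v"
      using uv \<open>0 < x\<close> by (auto intro!: B.antimono B.lower)
    have "K u - K v \<le> h u * (v powr \<beta> / \<beta> - u powr \<beta> / \<beta>)"
      using uv \<open>0 < x\<close> by (auto intro!: A.upper)
    also have "\<dots> \<le> h' u * (v powr \<beta> / \<beta> - u powr \<beta> / \<beta>)"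
      using uv \<open>0 < x\<close> A.weight_mono[of u v] by (intro mult_right_mono le) auto
    finally show "K u - K v \<le> h' u * (v powr \<beta> / \<beta> - u powr \<beta> / \<beta>)" .
  qed
  have "K x - 0 \<le> K' x - 0"
  proof (rule tendsto_le[OF trivial_limit_at_top_linorder])
    show "((\<lambda>z. K x - K z) \<longlongrightarrow> K x - 0) at_top" "((\<lambda>z. K' x - K' z) \<longlongrightarrow> K' x - 0) at_top"
      by (intro tendsto_intros A.lim B.lim)+
    show "\<forall>\<^sub>F z in at_top. K x - K z \<le> K' x - K' z"
      using eventually_ge_at_top[of x] by eventually_elim (rule *)
  qed
  then show ?thesis by simp
qed

section \<open>Karamata's theorem, the monotone density theorem and their converses\<close>

context tail_integral
begin

text \<open>Beyond some \<open>N\<close>, \<open>h (t * y)\<close> is within a factor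
  \<open>c\<close> of \<open>t powr (- \<rho> - \<beta>) * h y\<close> for all \<open>y\<close> at
  once, and integrating this inequality over \<open>y > x\<close> gives the same factor for
  \<open>K\<close>.\<close>

lemma h_RV_imp_K_RV:
  assumes h: "h \<in> RV (- \<rho> - \<beta>)"
  shows "K \<in> RV (- \<rho>)"
  unfolding RV_def
proof (intro CollectI allI impI)
  fix t :: real assume t: "t > 0"
  have hp: "0 < h x" if "0 < x" for x
    using h_pos[OF RV_eventually_nonzero[OF h] that] .
  have Kp: "0 < K x" if "0 < x" for x
    using K_pos_of_h_pos[OF RV_eventually_nonzero[OF h] that] .
  have hlim: "((\<lambda>x. h (t * x) / (t powr (- \<rho> - \<beta>) * h x)) \<longlongrightarrow> 1) at_top"
    using h t by (simp add: RV_def)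
  have tr: "t powr (- \<rho> - \<beta>) = t powr (- \<rho>) / t powr \<beta>"
    by (simp add: powr_diff)
  show "((\<lambda>x. K (t * x) / (t powr (- \<rho>) * K x)) \<longlongrightarrow> 1) at_top"
  proof (rule order_tendstoI)
    fix a :: real assume "a < 1"
    then obtain c where c: "max a 0 < c" "c < 1"
      using dense[of "max a 0" 1] by auto
    have "\<forall>\<^sub>F x in at_top. c < h (t * x) / (t powr (- \<rho> - \<beta>) * h x)"
      using hlim c(2) by (rule order_tendstoD)
    then obtain N where N: "\<And>x. x \<ge> N \<Longrightarrow> c < h (t * x) / (t powr (- \<rho> - \<beta>) * h x)"
      unfolding eventually_at_top_linorder by blast
    have "\<forall>\<^sub>F x in at_top. c \<le> K (t * x) / (t powr (- \<rho>) * K x)"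
      using eventually_ge_at_top[of N] eventually_gt_at_top[of 0]
    proof eventually_elim
      case (elim x)
      \<comment> \<open>The factors 1 put both sides into the form of \<open>scale\<close>: dilation
        1 on the left, constant 1 on the right.\<close>
      have "c * t powr (- \<rho>) * K (1 * x) \<le> 1 * K (t * x)"
      proof (rule tail_integral_le[OF scale scale])
        fix y assume "x \<le> y"
        then show "c * t powr (- \<rho>) * 1 powr \<beta> * h (1 * y) \<le> 1 * t powr \<beta> * h (t * y)"
          using N[of y] hp[of y] elim t by (simp add: tr field_simps)
      qed (use c t elim in auto)
      then show ?case
        using t Kp[OF elim(2)] by (simp add: field_simps)
    qed
    then show "\<forall>\<^sub>F x in at_top. a < K (t * x) / (t powr (- \<rho>) * K x)"
      by eventually_elim (use c in simp)
  next
    fix a :: real assume "1 < a"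
    then obtain c where c: "1 < c" "c < a"
      using dense by blast
    have "\<forall>\<^sub>F x in at_top. h (t * x) / (t powr (- \<rho> - \<beta>) * h x) < c"
      using hlim c(1) by (rule order_tendstoD)
    then obtain N where N: "\<And>x. x \<ge> N \<Longrightarrow> h (t * x) / (t powr (- \<rho> - \<beta>) * h x) < c"
      unfolding eventually_at_top_linorder by blast
    have "\<forall>\<^sub>F x in at_top. K (t * x) / (t powr (- \<rho>) * K x) \<le> c"
      using eventually_ge_at_top[of N] eventually_gt_at_top[of 0]
    proof eventually_elim
      case (elim x)
      have "1 * K (t * x) \<le> c * t powr (- \<rho>) * K (1 * x)"
      proof (rule tail_integral_le[OF scale scale])
        fix y assume "x \<le> y"
        then show "1 * t powr \<beta> * h (t * y) \<le> c * t powr (- \<rho>) * 1 powr \<beta> * h (1 * y)"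
          using N[of y] hp[of y] elim t by (simp add: tr field_simps)
      qed (use c t elim in auto)
      then show ?case
        using t Kp[OF elim(2)] by (simp add: field_simps)
    qed
    then show "\<forall>\<^sub>F x in at_top. K (t * x) / (t powr (- \<rho>) * K x) < a"
      by eventually_elim (use c in simp)
  qed
qed

text \<open>The increment of \<open>K\<close> between \<open>x\<close> and \<open>s * x\<close>
  bounds \<open>h x\<close> from below for \<open>s > 1\<close> and from above for
  \<open>s < 1\<close>. First \<open>x\<close> tends to infinity, then \<open>s\<close> tends to
  1.\<close>

lemma K_RV_imp_ratio:
  assumes K: "K \<in> RV (- \<rho>)"
  shows "((\<lambda>x. x powr \<beta> * h x / K x) \<longlongrightarrow> \<rho>) at_top"
proof -
  have Kp: "0 < K x" if "0 < x" for x
    using K_pos[OF RV_eventually_nonzero[OF K] that] .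
  have Klim: "((\<lambda>x. K (t * x) / K x) \<longlongrightarrow> t powr (- \<rho>)) at_top" if t: "t > 0" for t
  proof -
    have "((\<lambda>x. t powr (- \<rho>) * (K (t * x) / (t powr (- \<rho>) * K x))) \<longlongrightarrow> t powr (- \<rho>) * 1) at_top"
      using K t by (intro tendsto_intros) (auto simp: RV_def)
    with t show ?thesis by simp
  qed
  \<comment> \<open>The weight grows by \<open>x powr \<beta> * p s\<close> from \<open>x\<close> to
    \<open>s * x\<close>; the sign of \<open>p s\<close> is that of \<open>s - 1\<close>.\<close>
  define p where "p s = s powr \<beta> / \<beta> - 1 / \<beta>" for s :: real
  have p1: "p s > 0" if "s > 1" for s
    using weight_strict[of 1 s] that by (simp add: p_def)
  have p2: "p s < 0" if "0 < s" "s < 1" for s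
    using weight_strict[of s 1] that by (simp add: p_def)
  have lo: "(1 - K (s * x) / K x) / p s \<le> x powr \<beta> * h x / K x" if "s > 1" "x > 0" for s x
  proof -
    have "K x - K (s * x) \<le> h x * ((s * x) powr \<beta> / \<beta> - x powr \<beta> / \<beta>)"
      using that by (intro upper) auto
    also have "\<dots> = x powr \<beta> * h x * p s"
      using that by (simp add: p_def powr_mult algebra_simps)
    finally have "(K x - K (s * x)) / p s \<le> x powr \<beta> * h x"
      using p1[of s] that by (simp add: pos_divide_le_eq)
    then have "(K x - K (s * x)) / p s / K x \<le> x powr \<beta> * h x / K x"
      using Kp[of x] that by (intro divide_right_mono) auto
    then show ?thesis
      using that Kp[of x] by (simp add: diff_divide_distrib mult.commute)
  qed
  have up: "x powr \<beta> * h x / K x \<le> (1 - K (s * x) / K x) / p s" if "0 < s" "s < 1" "x > 0" for s x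
  proof -
    have "h x * (x powr \<beta> / \<beta> - (s * x) powr \<beta> / \<beta>) \<le> K (s * x) - K x"
      using that by (intro lower) (auto simp: mult_le_cancel_right1)
    also have "h x * (x powr \<beta> / \<beta> - (s * x) powr \<beta> / \<beta>) = - (x powr \<beta> * h x * p s)"
      using that by (simp add: p_def powr_mult algebra_simps)
    finally have "x powr \<beta> * h x \<le> (K x - K (s * x)) / p s"
      using p2[of s] that by (simp add: neg_le_divide_eq)
    then have "x powr \<beta> * h x / K x \<le> (K x - K (s * x)) / p s / K x"
      using Kp[of x] that by (intro divide_right_mono) auto
    then show ?thesis
      using that Kp[of x] by (simp add: diff_divide_distrib mult.commute)
  qed
  \<comment> \<open>A quotient of two difference quotients at 1: the numerator has derivative
    \<open>\<rho>\<close> there, and \<open>p\<close> has derivative 1.\<close>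
  have q: "((\<lambda>s. (1 - s powr (- \<rho>)) / p s) \<longlongrightarrow> \<rho>) (at 1)"
  proof -
    have "((\<lambda>s. s powr (- \<rho>)) has_real_derivative - \<rho>) (at 1)" "(p has_real_derivative 1) (at 1)"
      unfolding p_def using beta by (auto intro!: derivative_eq_intros)
    then have "((\<lambda>s. - ((s powr (- \<rho>) - 1) / (s - 1)) / ((p s - p 1) / (s - 1))) \<longlongrightarrow> - (- \<rho>) / 1) (at 1)"
      unfolding has_field_derivative_iff by (intro tendsto_intros) auto
    moreover have "\<forall>\<^sub>F s in at 1. - ((s powr (- \<rho>) - 1) / (s - 1)) / ((p s - p 1) / (s - 1)) = (1 - s powr (- \<rho>)) / p s"
      unfolding eventually_at by (intro exI[of _ 1]) (auto simp: p_def divide_simps)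
    ultimately show ?thesis by (simp add: filterlim_cong)
  qed
  have lim_s: "((\<lambda>x. (1 - K (s * x) / K x) / p s) \<longlongrightarrow> (1 - s powr (- \<rho>)) / p s) at_top"
    if "s > 0" "s \<noteq> 1" for s
    using that p1[of s] p2[of s] by (intro tendsto_intros Klim) fastforce+
  show ?thesis
  proof (rule order_tendstoI)
    fix a assume "a < \<rho>"
    have "\<forall>\<^sub>F s in at_right 1. a < (1 - s powr (- \<rho>)) / p s"
      using order_tendstoD(1)[OF q \<open>a < \<rho>\<close>] by (simp add: eventually_at_split)
    then have "\<forall>\<^sub>F s in at_right 1. a < (1 - s powr (- \<rho>)) / p s \<and> 1 < s"
      using eventually_at_right_less by (rule eventually_conj)
    then obtain s where s: "a < (1 - s powr (- \<rho>)) / p s" "1 < s"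
      using eventually_happens by fastforce
    then have "\<forall>\<^sub>F x in at_top. a < (1 - K (s * x) / K x) / p s"
      using lim_s[of s] by (intro order_tendstoD(1)) auto
    then show "\<forall>\<^sub>F x in at_top. a < x powr \<beta> * h x / K x"
      using eventually_gt_at_top[of 0] by eventually_elim (use lo[OF s(2)] in force)
  next
    fix a assume "\<rho> < a"
    have "\<forall>\<^sub>F s in at_left 1. (1 - s powr (- \<rho>)) / p s < a"
      using order_tendstoD(2)[OF q \<open>\<rho> < a\<close>] by (simp add: eventually_at_split)
    moreover have "\<forall>\<^sub>F s in at_left (1::real). 0 < s \<and> s < 1"
      using eventually_at_left_real[of 0 1] by simp
    ultimately have "\<forall>\<^sub>F s in at_left 1. (1 - s powr (- \<rho>)) / p s < a \<and> 0 < s \<and> s < 1"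
      by (rule eventually_conj)
    then obtain s where s: "(1 - s powr (- \<rho>)) / p s < a" "0 < s" "s < 1"
      using eventually_happens by fastforce
    then have "\<forall>\<^sub>F x in at_top. (1 - K (s * x) / K x) / p s < a"
      using lim_s[of s] by (intro order_tendstoD(2)) auto
    then show "\<forall>\<^sub>F x in at_top. x powr \<beta> * h x / K x < a"
      using eventually_gt_at_top[of 0] by eventually_elim (use up[OF s(2,3)] in force)
  qed
qed

text \<open>For \<open>c < \<rho> < d\<close>, eventually \<open>x powr c * K x\<close> decreases
  and \<open>x powr d * K x\<close> increases, which encloses \<open>K (t * x) / K x\<close> between
  powers of \<open>t\<close>. Finite increments replace the logarithmic derivative, since
  \<open>K\<close> need not be differentiable.\<close>

lemma ratio_imp_K_RV:
  assumes h: "\<forall>\<^sub>F x in at_top. h x \<noteq> 0"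
    and ratio: "((\<lambda>x. x powr \<beta> * h x / K x) \<longlongrightarrow> \<rho>) at_top"
  shows "K \<in> RV (- \<rho>)"
proof -
  have Kp: "0 < K x" if "0 < x" for x
    using K_pos_of_h_pos[OF h that] .
  have decr: "\<exists>N>0. \<forall>u v. N \<le> u \<longrightarrow> u \<le> v \<longrightarrow> v powr c * K v \<le> u powr c * K u" if "c < \<rho>" for c
  proof -
    obtain c' where c': "c < c'" "c' < \<rho>"
      using dense[OF \<open>c < \<rho>\<close>] by blast
    \<comment> \<open>With \<open>s = v / u\<close>, the lower sum and
      \<open>h v \<ge> c' * K v / v powr \<beta>\<close> give \<open>K u \<ge> (1 + c' * (1 - s powr
      (- \<beta>)) / \<beta>) * K v\<close>. So \<open>\<phi> s \<ge> 0\<close> suffices; it holds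
      just right of 1 because \<open>\<phi> 1 = 0\<close> and the derivative there is the slack
      \<open>c' - c\<close>.\<close>
    define \<phi> where "\<phi> s = 1 + c' * (1 - s powr (- \<beta>)) / \<beta> - s powr c" for s :: real
    have "(\<phi> has_real_derivative (c' - c)) (at 1)"
      unfolding \<phi>_def using beta by (auto intro!: derivative_eq_intros)
    then obtain \<delta> where \<delta>: "\<delta> > 0" "\<And>e. 0 < e \<Longrightarrow> e < \<delta> \<Longrightarrow> \<phi> 1 < \<phi> (1 + e)"
      using DERIV_pos_inc_right[of \<phi> "c' - c" 1] c'(1) by auto
    have "\<forall>\<^sub>F x in at_top. c' < x powr \<beta> * h x / K x \<and> 0 < x"
      using order_tendstoD(1)[OF ratio c'(2)] eventually_gt_at_top by (rule eventually_conj)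
    then obtain N where N: "\<And>x. x \<ge> N \<Longrightarrow> c' < x powr \<beta> * h x / K x \<and> 0 < x"
      unfolding eventually_at_top_linorder by blast
    have "v powr c * K v \<le> u powr c * K u" if "N \<le> u" "u \<le> v" for u v
    proof (rule antimono_if_locally_antimono[where f = "\<lambda>x. x powr c * K x", OF _ \<delta>(1) _ that])
      show "N > 0" using N by blast
    next
      fix u v assume uv: "N \<le> u" "u \<le> v" "v < (1 + \<delta>) * u"
      then have pos: "0 < u" "0 < v" using N[of u] N[of v] by auto
      have "\<phi> 1 \<le> \<phi> (1 + (v / u - 1))"
        using \<delta>(2)[of "v / u - 1"] uv pos by (cases "u = v") (auto simp: field_simps)
      then have "(v / u) powr c \<le> 1 + c' * (1 - (v / u) powr (- \<beta>)) / \<beta>"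
        by (simp add: \<phi>_def)
      then have "(v / u) powr c * K v \<le> (1 + c' * (1 - (v / u) powr (- \<beta>)) / \<beta>) * K v"
        using Kp[OF pos(2)] by (intro mult_right_mono) auto
      also have "\<dots> = K v + c' * K v / v powr \<beta> * (v powr \<beta> / \<beta> - u powr \<beta> / \<beta>)"
        using pos beta by (simp add: powr_minus powr_divide field_simps)
      also have "\<dots> \<le> K v + h v * (v powr \<beta> / \<beta> - u powr \<beta> / \<beta>)"
        using N[of v] uv pos Kp[OF pos(2)] weight_mono[OF pos(1) uv(2)]
        by (intro add_left_mono mult_right_mono) (auto simp: field_simps)
      also have "\<dots> \<le> K u"
        using lower[OF pos(1) uv(2)] by simp
      finally show "v powr c * K v \<le> u powr c * K u"
        using pos by (simp add: powr_divide field_simps)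
    qed
    then show ?thesis using N by blast
  qed
  have incr: "\<exists>N>0. \<forall>u v. N \<le> u \<longrightarrow> u \<le> v \<longrightarrow> u powr c * K u \<le> v powr c * K v" if "\<rho> < c" for c
  proof -
    obtain c' where c': "\<rho> < c'" "c' < c"
      using dense[OF \<open>\<rho> < c\<close>] by blast
    \<comment> \<open>The mirror image, from the upper sum at \<open>u\<close>:
      \<open>K v \<ge> (1 - c' * (s powr \<beta> - 1) / \<beta>) * K u\<close>, now with slack
      \<open>c - c'\<close>.\<close>
    define \<phi> where "\<phi> s = 1 - c' * (s powr \<beta> - 1) / \<beta> - s powr (- c)" for s :: real
    have "(\<phi> has_real_derivative (c - c')) (at 1)"
      unfolding \<phi>_def using beta by (auto intro!: derivative_eq_intros)
    then obtain \<delta> where \<delta>: "\<delta> > 0" "\<And>e. 0 < e \<Longrightarrow> e < \<delta> \<Longrightarrow> \<phi> 1 < \<phi> (1 + e)"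
      using DERIV_pos_inc_right[of \<phi> "c - c'" 1] c'(2) by auto
    have "\<forall>\<^sub>F x in at_top. x powr \<beta> * h x / K x < c' \<and> 0 < x"
      using order_tendstoD(2)[OF ratio c'(1)] eventually_gt_at_top by (rule eventually_conj)
    then obtain N where N: "\<And>x. x \<ge> N \<Longrightarrow> x powr \<beta> * h x / K x < c' \<and> 0 < x"
      unfolding eventually_at_top_linorder by blast
    have "- (v powr c * K v) \<le> - (u powr c * K u)" if "N \<le> u" "u \<le> v" for u v
    proof (rule antimono_if_locally_antimono[where f = "\<lambda>x. - (x powr c * K x)", OF _ \<delta>(1) _ that])
      show "N > 0" using N by blast
    next
      fix u v assume uv: "N \<le> u" "u \<le> v" "v < (1 + \<delta>) * u"
      then have pos: "0 < u" "0 < v" using N[of u] N[of v] by auto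
      have "\<phi> 1 \<le> \<phi> (1 + (v / u - 1))"
        using \<delta>(2)[of "v / u - 1"] uv pos by (cases "u = v") (auto simp: field_simps)
      then have "(v / u) powr (- c) \<le> 1 - c' * ((v / u) powr \<beta> - 1) / \<beta>"
        by (simp add: \<phi>_def)
      then have "(v / u) powr (- c) * K u \<le> (1 - c' * ((v / u) powr \<beta> - 1) / \<beta>) * K u"
        using Kp[OF pos(1)] by (intro mult_right_mono) auto
      also have "\<dots> = K u - c' * K u / u powr \<beta> * (v powr \<beta> / \<beta> - u powr \<beta> / \<beta>)"
        using pos beta by (simp add: powr_divide field_simps)
      also have "\<dots> \<le> K u - h u * (v powr \<beta> / \<beta> - u powr \<beta> / \<beta>)"
        using N[of u] uv pos Kp[OF pos(1)] weight_mono[OF pos(1) uv(2)]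
        by (intro diff_left_mono mult_right_mono) (auto simp: field_simps)
      also have "\<dots> \<le> K v"
        using upper[OF pos(1) uv(2)] by simp
      finally show "- (v powr c * K v) \<le> - (u powr c * K u)"
        using pos by (simp add: powr_divide powr_minus field_simps)
    qed
    then show ?thesis using N by (intro exI[of _ N]) auto
  qed
  show ?thesis
    unfolding RV_def
  proof (intro CollectI allI impI)
    fix t :: real assume t: "t > 0"
    \<comment> \<open>The two exponents exchange roles as \<open>t\<close> passes 1, hence
      \<open>min\<close> and \<open>max\<close>.\<close>
    have bounds: "\<forall>\<^sub>F x in at_top. min (t powr (- c)) (t powr (- d)) \<le> K (t * x) / K x
        \<and> K (t * x) / K x \<le> max (t powr (- c)) (t powr (- d))" if "c < \<rho>" "\<rho> < d" for c d
    proof -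
      obtain M N where M: "M > 0" "\<And>u v. M \<le> u \<Longrightarrow> u \<le> v \<Longrightarrow> v powr c * K v \<le> u powr c * K u"
        and N: "N > 0" "\<And>u v. N \<le> u \<Longrightarrow> u \<le> v \<Longrightarrow> u powr d * K u \<le> v powr d * K v"
        using decr[OF \<open>c < \<rho>\<close>] incr[OF \<open>\<rho> < d\<close>] by blast
      have tx: "filterlim (\<lambda>x::real. t * x) at_top at_top"
        by (rule filterlim_tendsto_pos_mult_at_top[OF tendsto_const t filterlim_ident])
      show ?thesis
        using eventually_ge_at_top[of M] eventually_ge_at_top[of N]
          eventually_compose_filterlim[OF eventually_ge_at_top[of M] tx]
          eventually_compose_filterlim[OF eventually_ge_at_top[of N] tx]
      proof eventually_elim
        case (elim x)
        then have x: "x > 0" "K x > 0" using M(1) Kp by auto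
        show ?case
        proof (cases "t \<ge> 1")
          case True
          then have "x \<le> t * x" using x by simp
          then have "(t * x) powr c * K (t * x) \<le> x powr c * K x" "x powr d * K x \<le> (t * x) powr d * K (t * x)"
            using M(2)[of x "t * x"] N(2)[of x "t * x"] elim by auto
          then have "t powr (- d) \<le> K (t * x) / K x" "K (t * x) / K x \<le> t powr (- c)"
            using x t by (simp_all add: powr_mult powr_minus field_simps)
          then show ?thesis by linarith
        next
          case False
          then have "t * x \<le> x" using x by simp
          then have "x powr c * K x \<le> (t * x) powr c * K (t * x)" "(t * x) powr d * K (t * x) \<le> x powr d * K x"
            using M(2)[of "t * x" x] N(2)[of "t * x" x] elim by auto
          then have "t powr (- c) \<le> K (t * x) / K x" "K (t * x) / K x \<le> t powr (- d)"
            using x t by (simp_all add: powr_mult powr_minus field_simps)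
          then show ?thesis by linarith
        qed
      qed
    qed
    \<comment> \<open>\<open>s\<close> is a sign, used as 1 and -1: the exponents
      \<open>\<rho> + e\<close> and \<open>\<rho> - e\<close> close in on
      \<open>\<rho>\<close>.\<close>
    have tc: "((\<lambda>e. t powr (- (\<rho> + s * e))) \<longlongrightarrow> t powr (- (\<rho> + s * 0))) (at_right 0)" for s
      using t by (intro tendsto_intros) auto
    have "((\<lambda>x. K (t * x) / K x) \<longlongrightarrow> t powr (- \<rho>)) at_top"
    proof (rule order_tendstoI)
      fix a assume a: "a < t powr (- \<rho>)"
      have "\<forall>\<^sub>F e in at_right (0::real). a < t powr (- (\<rho> + (- 1) * e)) \<and> a < t powr (- (\<rho> + 1 * e)) \<and> 0 < e"
        using a by (intro eventually_conj order_tendstoD(1)[OF tc] eventually_at_right_less) auto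
      then obtain e where "a < t powr (- (\<rho> - e))" "a < t powr (- (\<rho> + e))" "0 < e"
        using eventually_happens by fastforce
      then show "\<forall>\<^sub>F x in at_top. a < K (t * x) / K x"
        using bounds[of "\<rho> - e" "\<rho> + e"] by (auto elim!: eventually_mono)
    next
      fix a assume a: "t powr (- \<rho>) < a"
      have "\<forall>\<^sub>F e in at_right (0::real). t powr (- (\<rho> + (- 1) * e)) < a \<and> t powr (- (\<rho> + 1 * e)) < a \<and> 0 < e"
        using a by (intro eventually_conj order_tendstoD(2)[OF tc] eventually_at_right_less) auto
      then obtain e where "t powr (- (\<rho> - e)) < a" "t powr (- (\<rho> + e)) < a" "0 < e"
        using eventually_happens by fastforce
      then show "\<forall>\<^sub>F x in at_top. K (t * x) / K x < a"
        using bounds[of "\<rho> - e" "\<rho> + e"] by (auto elim!: eventually_mono)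
    qed
    then have "((\<lambda>x. K (t * x) / K x / t powr (- \<rho>)) \<longlongrightarrow> t powr (- \<rho>) / t powr (- \<rho>)) at_top"
      using t by (intro tendsto_divide tendsto_const) auto
    then show "((\<lambda>x. K (t * x) / (t powr (- \<rho>) * K x)) \<longlongrightarrow> 1) at_top"
      using t by (simp add: mult.commute)
  qed
qed

text \<open>For the converse, the monotone density limit says that \<open>h x\<close> is asymptotic
  to \<open>\<rho> * x powr (- \<beta>) * K x\<close>; \<open>RV_asymp\<close> requires this
  constant to be nonzero.\<close>

theorem h_RV_iff_K_RV:
  assumes "\<rho> \<noteq> 0"
  shows "h \<in> RV (- \<rho> - \<beta>) \<longleftrightarrow> K \<in> RV (- \<rho>)"
proof
  assume K: "K \<in> RV (- \<rho>)"
  have "((\<lambda>x. h x / (x powr (- \<beta>) * K x)) \<longlongrightarrow> \<rho>) at_top"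
    using K_RV_imp_ratio[OF K] by (simp add: powr_minus field_simps)
  from RV_asymp[OF K assms this] show "h \<in> RV (- \<rho> - \<beta>)"
    by simp
qed (rule h_RV_imp_K_RV)

theorem K_RV_iff_ratio:
  assumes "\<rho> \<noteq> 0"
  shows "K \<in> RV (- \<rho>) \<longleftrightarrow>
    (\<forall>\<^sub>F x in at_top. 0 < h x) \<and> ((\<lambda>x. K x / (x powr \<beta> * h x)) \<longlongrightarrow> 1 / \<rho>) at_top"
proof (intro iffI conjI; (elim conjE)?)
  assume K: "K \<in> RV (- \<rho>)"
  then have "h \<in> RV (- \<rho> - \<beta>)"
    using h_RV_iff_K_RV[OF assms] by simp
  from h_pos[OF RV_eventually_nonzero[OF this]]
  show "\<forall>\<^sub>F x in at_top. 0 < h x"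
    by (rule eventually_mono[OF eventually_gt_at_top])
  show "((\<lambda>x. K x / (x powr \<beta> * h x)) \<longlongrightarrow> 1 / \<rho>) at_top"
    using tendsto_inverse[OF K_RV_imp_ratio[OF K] assms] by (simp add: inverse_eq_divide)
next
  assume h: "\<forall>\<^sub>F x in at_top. 0 < h x"
    and ratio: "((\<lambda>x. K x / (x powr \<beta> * h x)) \<longlongrightarrow> 1 / \<rho>) at_top"
  show "K \<in> RV (- \<rho>)"
  proof (rule ratio_imp_K_RV)
    show "\<forall>\<^sub>F x in at_top. h x \<noteq> 0"
      using h by (auto elim: eventually_mono)
    show "((\<lambda>x. x powr \<beta> * h x / K x) \<longlongrightarrow> \<rho>) at_top"
      using tendsto_inverse[OF ratio] assms by (simp add: inverse_eq_divide)
  qed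
qed

end

section \<open>Distributions with a finite moment\<close>

locale finite_moment =
  fixes F :: "real \<Rightarrow> real" and \<alpha> :: real
  assumes dist: "distribution_function_nonneg F" and F0: "F 0 = 0"
    and alpha: "\<alpha> > 0" and moment_finite: "moment F \<alpha> < \<infinity>"
begin

abbreviation M :: "real measure" where "M \<equiv> interval_measure F"
abbreviation m :: real where "m \<equiv> enn2real (moment F \<alpha>)"
text \<open>The part of the moment carried by points beyond \<open>x\<close>.\<close>

abbreviation U :: "real \<Rightarrow> real" where "U x \<equiv> m - H F \<alpha> x"

lemma F_mono: "x \<le> y \<Longrightarrow> F x \<le> F y"
  using dist by (auto simp: distribution_function_nonneg_def mono_def)

lemma F_right_cont: "continuous (at_right x) F"
  using dist by (auto simp: distribution_function_nonneg_def)

lemma F_neg: "x < 0 \<Longrightarrow> F x = 0"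
  using dist by (auto simp: distribution_function_nonneg_def)

lemma F_lim: "(F \<longlongrightarrow> 1) at_top"
  using dist by (auto simp: distribution_function_nonneg_def)

lemma F_le_1: "F x \<le> 1"
proof (rule tendsto_lowerbound[OF F_lim])
  show "\<forall>\<^sub>F y in at_top. F x \<le> F y"
    using eventually_ge_at_top[of x] by eventually_elim (rule F_mono)
qed simp

lemma tail_nonneg: "0 \<le> tail F x"
  using F_le_1[of x] by (simp add: tail_def)

lemma tail_antimono: "x \<le> y \<Longrightarrow> tail F y \<le> tail F x"
  using F_mono[of x y] by (simp add: tail_def)

lemma emeasure_Ioc: "a \<le> b \<Longrightarrow> emeasure M {a<..b} = ennreal (F b - F a)"
  by (intro emeasure_interval_measure_Ioc F_mono F_right_cont)

lemma measure_Ioc: "a \<le> b \<Longrightarrow> measure M {a<..b} = F b - F a"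
  by (intro measure_interval_measure_Ioc F_mono F_right_cont)

text \<open>There is no mass at 0, because \<open>F\<close> vanishes at 0 and to its left; the
  closed interval is enclosed by two half-open ones of equal mass.\<close>

lemma emeasure_Icc_0:
  assumes "0 \<le> x"
  shows "emeasure M {0..x} = ennreal (F x)"
proof (rule antisym)
  have "emeasure M {0..x} \<le> emeasure M {-1<..x}"
    by (intro emeasure_mono) auto
  then show "emeasure M {0..x} \<le> ennreal (F x)"
    using assms by (simp add: emeasure_Ioc F_neg)
  have "emeasure M {0<..x} \<le> emeasure M {0..x}"
    by (intro emeasure_mono) auto
  then show "ennreal (F x) \<le> emeasure M {0..x}"
    using assms by (simp add: emeasure_Ioc F0)
qed

section \<open>Increments of the truncated moment and of the integrated tail\<close>

lemma integrable_powr: "set_integrable M {0..} (\<lambda>y. y powr \<alpha>)"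
  and m_eq: "m = (LINT y:{0..}|M. y powr \<alpha>)"
proof -
  have eq: "moment F \<alpha> = (\<integral>\<^sup>+y. ennreal (indicator {0..} y *\<^sub>R y powr \<alpha>) \<partial>M)"
    unfolding moment_def by (intro nn_integral_cong) (simp split: split_indicator)
  show "set_integrable M {0..} (\<lambda>y. y powr \<alpha>)"
    unfolding set_integrable_def
    by (rule integrableI_nonneg) (use moment_finite eq in auto)
  show "m = (LINT y:{0..}|M. y powr \<alpha>)"
    unfolding eq set_lebesgue_integral_def by (rule integral_eq_nn_integral[symmetric]) auto
qed

lemma H_lim: "(H F \<alpha> \<longlongrightarrow> m) at_top"
  unfolding H_def[abs_def] m_eq
  by (rule tendsto_set_lebesgue_integral_at_top[OF _ integrable_powr]) auto

lemma U_lim: "(U \<longlongrightarrow> 0) at_top"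
  using tendsto_diff[OF tendsto_const H_lim, of m] by simp

text \<open>On \<open>{x<..z}\<close>, a set of mass \<open>F z - F x\<close>, the integrand lies
  between its values at the endpoints.\<close>

lemma H_increment_bounds:
  assumes "0 \<le> x" "x \<le> z"
  shows "x powr \<alpha> * (F z - F x) \<le> H F \<alpha> z - H F \<alpha> x"
    and "H F \<alpha> z - H F \<alpha> x \<le> z powr \<alpha> * (F z - F x)"
proof -
  have int: "set_integrable M A (\<lambda>y. y powr \<alpha>)" if "A \<subseteq> {0..}" "A \<in> sets borel" for A
    using set_integrable_subset[OF integrable_powr] that by simp
  have const: "set_integrable M {x<..z} (\<lambda>_. c)" "(LINT y:{x<..z}|M. c) = c * (F z - F x)" for c :: real
    using assms emeasure_Ioc[of x z]
    by (simp_all add: set_integral_const measure_Ioc set_integrable_def)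
  have "(LINT y:{0..x} \<union> {x<..z}|M. y powr \<alpha>) = H F \<alpha> x + (LINT y:{x<..z}|M. y powr \<alpha>)"
    unfolding H_def using assms by (intro set_integral_Un int) auto
  moreover have "{0..x} \<union> {x<..z} = {0..z}"
    using assms by auto
  ultimately have eq: "H F \<alpha> z - H F \<alpha> x = (LINT y:{x<..z}|M. y powr \<alpha>)"
    by (simp add: H_def)
  have "(LINT y:{x<..z}|M. x powr \<alpha>) \<le> (LINT y:{x<..z}|M. y powr \<alpha>)"
    using assms alpha by (intro set_integral_mono const int) (auto intro!: powr_mono2)
  then show "x powr \<alpha> * (F z - F x) \<le> H F \<alpha> z - H F \<alpha> x"
    by (simp add: eq const)
  have "(LINT y:{x<..z}|M. y powr \<alpha>) \<le> (LINT y:{x<..z}|M. z powr \<alpha>)"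
    using assms alpha by (intro set_integral_mono const int) (auto intro!: powr_mono2)
  then show "H F \<alpha> z - H F \<alpha> x \<le> z powr \<alpha> * (F z - F x)"
    by (simp add: eq const)
qed

lemma H_0: "H F \<alpha> 0 = 0"
  unfolding H_def by (rule set_lebesgue_integral_cong[THEN trans, of _ _ _ "\<lambda>_. 0"]) auto

text \<open>The exponent exceeds -1, so the singularity at 0 for \<open>\<alpha> < 1\<close> is
  integrable; nonnegativity turns the gauge integral into a Lebesgue integral.\<close>

lemma powr_integrable: "0 \<le> x \<Longrightarrow> set_integrable lborel {0..x} (\<lambda>y. y powr (\<alpha> - 1))"
  and powr_integral: "0 \<le> x \<Longrightarrow> (LINT y:{0..x}|lborel. y powr (\<alpha> - 1)) = x powr \<alpha> / \<alpha>"
proof -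
  assume x: "0 \<le> x"
  have hi: "((\<lambda>y. y powr (\<alpha> - 1)) has_integral x powr \<alpha> / \<alpha>) {0..x}"
    using has_integral_powr_from_0[of "\<alpha> - 1" x] alpha x by simp
  have nn: "(\<integral>\<^sup>+y. ennreal (indicator {0..x} y *\<^sub>R y powr (\<alpha> - 1)) \<partial>lborel) = ennreal (x powr \<alpha> / \<alpha>)"
    using nn_integral_has_integral_lebesgue[OF _ hi] by simp
  show int: "set_integrable lborel {0..x} (\<lambda>y. y powr (\<alpha> - 1))"
    unfolding set_integrable_def by (rule integrableI_nonneg) (use nn in auto)
  show "(LINT y:{0..x}|lborel. y powr (\<alpha> - 1)) = x powr \<alpha> / \<alpha>"
    using hi set_borel_integral_eq_integral(2)[OF int] by (simp add: integral_unique)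
qed

lemma W_increment_bounds:
  assumes "0 \<le> x" "x \<le> z"
  shows "tail F z * (z powr \<alpha> / \<alpha> - x powr \<alpha> / \<alpha>) \<le> W F \<alpha> z - W F \<alpha> x"
    and "W F \<alpha> z - W F \<alpha> x \<le> tail F x * (z powr \<alpha> / \<alpha> - x powr \<alpha> / \<alpha>)"
proof -
  let ?g = "\<lambda>y. y powr (\<alpha> - 1)"
  have [measurable]: "tail F \<in> borel_measurable borel"
    unfolding tail_def[abs_def]
    using borel_measurable_mono[of F] F_mono by (auto intro!: borel_measurable_diff monoI)
  have split: "{0..x} \<union> {x<..z} = {0..z}"
    using assms by auto
  have g: "set_integrable lborel A ?g" if "A \<subseteq> {0..z}" "A \<in> sets borel" for A
    using set_integrable_subset[OF powr_integrable[of z]] that assms by simp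
  \<comment> \<open>The tail lies between 0 and 1, so \<open>?g\<close> dominates the product, also
    near 0.\<close>
  have gt: "set_integrable lborel A (\<lambda>y. ?g y * tail F y)" if "A \<subseteq> {0..z}" "A \<in> sets borel" for A
  proof (rule set_integrable_bound[OF g[OF that]])
    show "set_borel_measurable lborel A (\<lambda>y. ?g y * tail F y)"
      using that unfolding set_borel_measurable_def by measurable
    show "AE y in lborel. y \<in> A \<longrightarrow> norm (?g y * tail F y) \<le> norm (?g y)"
    proof (intro AE_I2 impI)
      fix y assume "y \<in> A"
      then have "0 \<le> tail F y \<and> tail F y \<le> 1"
        using tail_nonneg[of y] tail_antimono[of 0 y] that F0 by (auto simp: tail_def)
      then show "norm (?g y * tail F y) \<le> norm (?g y)"
        by (simp add: abs_mult mult_left_le)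
    qed
  qed
  have "(LINT y:{0..x} \<union> {x<..z}|lborel. ?g y) = (LINT y:{0..x}|lborel. ?g y) + (LINT y:{x<..z}|lborel. ?g y)"
    using assms by (intro set_integral_Un g) auto
  then have g_eq: "(LINT y:{x<..z}|lborel. ?g y) = z powr \<alpha> / \<alpha> - x powr \<alpha> / \<alpha>"
    using assms by (simp add: split powr_integral)
  have "(LINT y:{0..x} \<union> {x<..z}|lborel. ?g y * tail F y) = W F \<alpha> x + (LINT y:{x<..z}|lborel. ?g y * tail F y)"
    unfolding W_def using assms by (intro set_integral_Un gt) auto
  then have W_eq: "W F \<alpha> z - W F \<alpha> x = (LINT y:{x<..z}|lborel. ?g y * tail F y)"
    by (simp add: W_def split)
  have "(LINT y:{x<..z}|lborel. ?g y * tail F z) \<le> (LINT y:{x<..z}|lborel. ?g y * tail F y)"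
    using assms by (intro set_integral_mono gt set_integrable_mult_left g) (auto intro!: mult_left_mono tail_antimono)
  then show "tail F z * (z powr \<alpha> / \<alpha> - x powr \<alpha> / \<alpha>) \<le> W F \<alpha> z - W F \<alpha> x"
    by (simp add: W_eq g_eq mult.commute)
  have "(LINT y:{x<..z}|lborel. ?g y * tail F y) \<le> (LINT y:{x<..z}|lborel. ?g y * tail F x)"
    using assms by (intro set_integral_mono gt set_integrable_mult_left g) (auto intro!: mult_left_mono tail_antimono)
  then show "W F \<alpha> z - W F \<alpha> x \<le> tail F x * (z powr \<alpha> / \<alpha> - x powr \<alpha> / \<alpha>)"
    by (simp add: W_eq g_eq mult.commute)
qed

text \<open>\<open>0 powr (\<alpha> - 1)\<close> is 0 even for a negative exponent, so the integrand
  vanishes on \<open>{0..0}\<close>.\<close>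

lemma W_0: "W F \<alpha> 0 = 0"
  unfolding W_def by (rule set_lebesgue_integral_cong[THEN trans, of _ _ _ "\<lambda>_. 0"]) auto

text \<open>Integration by parts. Both sides vanish at \<open>0\<close> and have increments squeezed between the
  same lower and upper sums, so no Stieltjes integration by parts is needed.\<close>

lemma W_eq:
  assumes "0 \<le> x"
  shows "W F \<alpha> x = (H F \<alpha> x + x powr \<alpha> * tail F x) / \<alpha>"
proof -
  define Q where "Q x = (H F \<alpha> x + x powr \<alpha> * tail F x) / \<alpha>" for x
  have Q: "tail F v * (v powr \<alpha> / \<alpha> - u powr \<alpha> / \<alpha>) \<le> Q v - Q u"
    "Q v - Q u \<le> tail F u * (v powr \<alpha> / \<alpha> - u powr \<alpha> / \<alpha>)" if "0 \<le> u" "u \<le> v" for u v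
  proof -
    have "tail F v * (v powr \<alpha> - u powr \<alpha>)
        \<le> (H F \<alpha> v + v powr \<alpha> * tail F v) - (H F \<alpha> u + u powr \<alpha> * tail F u)"
      "(H F \<alpha> v + v powr \<alpha> * tail F v) - (H F \<alpha> u + u powr \<alpha> * tail F u)
        \<le> tail F u * (v powr \<alpha> - u powr \<alpha>)"
      using H_increment_bounds[OF that] by (simp_all add: tail_def algebra_simps)
    note this[THEN divide_right_mono, of \<alpha>]
    then show "tail F v * (v powr \<alpha> / \<alpha> - u powr \<alpha> / \<alpha>) \<le> Q v - Q u"
      "Q v - Q u \<le> tail F u * (v powr \<alpha> / \<alpha> - u powr \<alpha> / \<alpha>)"
      using alpha by (simp_all add: Q_def flip: diff_divide_distrib)
  qed
  have cont: "continuous_on {0..x} (\<lambda>y. y powr \<alpha> / \<alpha>)"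
    using alpha by (intro continuous_intros continuous_on_powr') auto
  note comparison = increment_comparison[OF assms cont, of "tail F"]
  \<comment> \<open>\<open>increment_comparison\<close> is stated for differences
    \<open>K u - K v\<close>, hence the minus signs; using it in both directions gives
    equality.\<close>
  have "- W F \<alpha> 0 - - W F \<alpha> x \<le> - Q 0 - - Q x"
    by (rule comparison) (use W_increment_bounds Q in \<open>auto intro: tail_antimono\<close>)
  moreover have "- Q 0 - - Q x \<le> - W F \<alpha> 0 - - W F \<alpha> x"
    by (rule comparison) (use W_increment_bounds Q in \<open>auto intro: tail_antimono\<close>)
  moreover have "Q 0 = 0"
    using alpha by (simp add: Q_def H_0)
  ultimately show ?thesis
    by (simp add: H_0 W_0 Q_def)
qed

section \<open>Behaviour at infinity and identities between the transforms\<close>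

text \<open>A Markov-type bound, from letting \<open>z\<close> tend to infinity in
  \<open>H_increment_bounds\<close>. It makes the boundary term of the integration by parts vanish
  at infinity.\<close>

lemma powr_tail_le_U:
  assumes "0 \<le> x"
  shows "x powr \<alpha> * tail F x \<le> U x"
proof (rule tendsto_le[OF trivial_limit_at_top_linorder])
  show "((\<lambda>z. H F \<alpha> z - H F \<alpha> x) \<longlongrightarrow> U x) at_top"
    by (intro tendsto_intros H_lim)
  show "((\<lambda>z. x powr \<alpha> * (F z - F x)) \<longlongrightarrow> x powr \<alpha> * tail F x) at_top"
    unfolding tail_def by (intro tendsto_intros F_lim)
  show "\<forall>\<^sub>F z in at_top. x powr \<alpha> * (F z - F x) \<le> H F \<alpha> z - H F \<alpha> x"
    using eventually_ge_at_top[of x] by eventually_elim (rule H_increment_bounds(1)[OF assms])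
qed

lemma powr_tail_lim: "((\<lambda>x. x powr \<alpha> * tail F x) \<longlongrightarrow> 0) at_top"
proof (rule tendsto_sandwich[OF _ _ tendsto_const U_lim])
  show "\<forall>\<^sub>F x in at_top. 0 \<le> x powr \<alpha> * tail F x"
    by (simp add: tail_nonneg)
  show "\<forall>\<^sub>F x in at_top. x powr \<alpha> * tail F x \<le> U x"
    using eventually_ge_at_top[of 0] by eventually_elim (rule powr_tail_le_U)
qed

lemma W_infinity_eq: "W_infinity F \<alpha> = m / \<alpha>"
proof -
  have "((\<lambda>x. (H F \<alpha> x + x powr \<alpha> * tail F x) / \<alpha>) \<longlongrightarrow> (m + 0) / \<alpha>) at_top"
    using alpha by (intro tendsto_intros H_lim powr_tail_lim) auto
  moreover have "\<forall>\<^sub>F x in at_top. W F \<alpha> x = (H F \<alpha> x + x powr \<alpha> * tail F x) / \<alpha>"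
    using eventually_ge_at_top[of 0] by eventually_elim (rule W_eq)
  ultimately have "(W F \<alpha> \<longlongrightarrow> m / \<alpha>) at_top"
    by (simp add: filterlim_cong)
  then show ?thesis
    unfolding W_infinity_def by (intro tendsto_Lim) auto
qed

lemma W_bar_eq: "0 \<le> x \<Longrightarrow> W_bar F \<alpha> x = (U x - x powr \<alpha> * tail F x) / \<alpha>"
  using alpha by (simp add: W_bar_def W_infinity_eq W_eq field_simps)

lemma W_bar_lim: "(W_bar F \<alpha> \<longlongrightarrow> 0) at_top"
proof -
  have "((\<lambda>x. (U x - x powr \<alpha> * tail F x) / \<alpha>) \<longlongrightarrow> (0 - 0) / \<alpha>) at_top"
    using alpha by (intro tendsto_intros U_lim powr_tail_lim) auto
  moreover have "\<forall>\<^sub>F x in at_top. W_bar F \<alpha> x = (U x - x powr \<alpha> * tail F x) / \<alpha>"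
    using eventually_ge_at_top[of 0] by eventually_elim (rule W_bar_eq)
  ultimately show ?thesis
    by (simp add: filterlim_cong)
qed

text \<open>Splitting the integrand gives
  \<open>G F \<alpha> x = F x - x powr (- \<alpha>) * H F \<alpha> x\<close>;
  \<open>W_bar_eq\<close> then removes \<open>H\<close>.\<close>

lemma G_bar_eq:
  assumes "0 < x"
  shows "x powr (- \<alpha>) * m - G_bar F \<alpha> x = \<alpha> * x powr (- \<alpha>) * W_bar F \<alpha> x"
proof -
  have int: "set_integrable M {0..x} (\<lambda>t. t powr \<alpha>)"
    using set_integrable_subset[OF integrable_powr] by simp
  have one: "set_integrable M {0..x} (\<lambda>_. 1)" "(LINT t:{0..x}|M. 1) = F x"
    using assms emeasure_Icc_0[of x] F_mono[of 0 x] F0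
    by (simp_all add: set_integral_const measure_def set_integrable_def)
  have "G F \<alpha> x = (LINT t:{0..x}|M. 1 - t powr \<alpha> * x powr (- \<alpha>))"
    unfolding G_def using assms
    by (intro set_lebesgue_integral_cong) (auto simp: powr_divide powr_minus field_simps)
  also have "\<dots> = F x - H F \<alpha> x * x powr (- \<alpha>)"
    using int one by (subst set_integral_diff) (simp_all add: H_def)
  finally have "x powr (- \<alpha>) * m - G_bar F \<alpha> x = x powr (- \<alpha>) * U x - tail F x"
    by (simp add: G_bar_def tail_def algebra_simps)
  also have "\<dots> = x powr (- \<alpha>) * (U x - x powr \<alpha> * tail F x)"
    using assms by (simp add: powr_minus right_diff_distrib)
  finally show ?thesis
    using assms alpha by (simp add: W_bar_eq)
qed

lemma W_bar_tail_integral: "tail_integral (tail F) (W_bar F \<alpha>) \<alpha>"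
  using alpha W_increment_bounds W_bar_lim tail_antimono tail_nonneg
  by unfold_locales (auto simp: W_bar_def)

text \<open>The same device with \<open>- \<alpha>\<close> in place of \<open>\<alpha>\<close>: \<open>x powr (- \<alpha>) * W_bar F \<alpha> x\<close> is the
  integral of \<open>y powr (- \<alpha> - 1) * U y\<close> over \<open>y > x\<close>.\<close>

lemma W_bar_powr_tail_integral: "tail_integral U (\<lambda>x. x powr (- \<alpha>) * W_bar F \<alpha> x) (- \<alpha>)"
proof
  show "- \<alpha> \<noteq> 0" using alpha by simp
  fix x z :: real assume x: "0 < x"
  have "0 \<le> x powr \<alpha> * tail F x"
    by (simp add: tail_nonneg)
  then show "0 \<le> U x"
    using powr_tail_le_U[of x] x by simp
  assume xz: "x \<le> z"
  have H: "x powr \<alpha> * (F z - F x) \<le> H F \<alpha> z - H F \<alpha> x" "H F \<alpha> z - H F \<alpha> x \<le> z powr \<alpha> * (F z - F x)"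
    using H_increment_bounds[of x z] x xz by auto
  have "0 \<le> x powr \<alpha> * (F z - F x)"
    using F_mono[OF xz] by simp
  with H show "U z \<le> U x" by simp
  have V: "y powr (- \<alpha>) * W_bar F \<alpha> y = (y powr (- \<alpha>) * U y - tail F y) / \<alpha>" if "0 < y" for y
    using that alpha by (simp add: W_bar_eq powr_minus field_simps)
  have V_diff: "x powr (- \<alpha>) * W_bar F \<alpha> x - z powr (- \<alpha>) * W_bar F \<alpha> z
      = (x powr (- \<alpha>) * U x - z powr (- \<alpha>) * U z - (F z - F x)) / \<alpha>"
    using x xz by (simp only: V tail_def flip: diff_divide_distrib) simp
  \<comment> \<open>\<open>U x - U z\<close> equals \<open>H F \<alpha> z - H F \<alpha> x\<close>,
    so these inequalities are the required bounds after the mixed terms cancel.\<close>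
  have "F z - F x \<le> x powr (- \<alpha>) * (H F \<alpha> z - H F \<alpha> x)" "z powr (- \<alpha>) * (H F \<alpha> z - H F \<alpha> x) \<le> F z - F x"
    using H x xz by (simp_all add: powr_minus field_simps)
  then have "U z * (x powr (- \<alpha>) - z powr (- \<alpha>)) \<le> x powr (- \<alpha>) * U x - z powr (- \<alpha>) * U z - (F z - F x)"
    "x powr (- \<alpha>) * U x - z powr (- \<alpha>) * U z - (F z - F x) \<le> U x * (x powr (- \<alpha>) - z powr (- \<alpha>))"
    by (simp_all add: algebra_simps)
  note this[THEN divide_right_mono, of \<alpha>]
  then show "U z * (z powr (- \<alpha>) / (- \<alpha>) - x powr (- \<alpha>) / (- \<alpha>))
      \<le> x powr (- \<alpha>) * W_bar F \<alpha> x - z powr (- \<alpha>) * W_bar F \<alpha> z"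
    "x powr (- \<alpha>) * W_bar F \<alpha> x - z powr (- \<alpha>) * W_bar F \<alpha> z
      \<le> U x * (z powr (- \<alpha>) / (- \<alpha>) - x powr (- \<alpha>) / (- \<alpha>))"
    using alpha unfolding V_diff by (simp_all add: diff_divide_distrib right_diff_distrib)
next
  have "((\<lambda>x. x powr (- \<alpha>)) \<longlongrightarrow> 0) at_top"
    using alpha by (intro tendsto_neg_powr filterlim_ident) auto
  from tendsto_mult[OF this W_bar_lim]
  show "((\<lambda>x. x powr (- \<alpha>) * W_bar F \<alpha> x) \<longlongrightarrow> 0) at_top" by simp
qed

end

section \<open>Combining the two tail integrals\<close>

theorem theorem6:
  fixes F :: "real \<Rightarrow> real" and \<alpha> \<theta> :: real
  assumes "distribution_function_nonneg F" and "F 0 = 0"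
    and "\<alpha> > 0" and "\<theta> > \<alpha>"
    and "moment F \<alpha> < \<infinity>"
  shows
    "let m = enn2real (moment F \<alpha>);
         a = (tail F \<in> RV (- \<theta>));
         b = (W_bar F \<alpha> \<in> RV (\<alpha> - \<theta>));
         c = ((\<lambda>x. x powr (- \<alpha>) * m - G_bar F \<alpha> x) \<in> RV (- \<theta>));
         d = ((\<forall>\<^sub>F x in at_top. tail F x > 0) \<and>
              ((\<lambda>x. W_bar F \<alpha> x / (x powr \<alpha> * tail F x)) \<longlongrightarrow> 1 / (\<theta> - \<alpha>)) at_top);
         e = ((\<forall>\<^sub>F x in at_top. tail F x > 0) \<and>
              ((\<lambda>x. (x powr (- \<alpha>) * m - G_bar F \<alpha> x) / tail F x) \<longlongrightarrow> \<alpha> / (\<theta> - \<alpha>)) at_top);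
         f = ((\<lambda>x. m - H F \<alpha> x) \<in> RV (\<alpha> - \<theta>));
         g = ((\<forall>\<^sub>F x in at_top. tail F x > 0) \<and>
              ((\<lambda>x. (m - H F \<alpha> x) / (x powr \<alpha> * tail F x)) \<longlongrightarrow> \<theta> / (\<theta> - \<alpha>)) at_top)
     in (a \<longleftrightarrow> b) \<and> (a \<longleftrightarrow> c) \<and> (a \<longleftrightarrow> d) \<and> (a \<longleftrightarrow> e) \<and> (a \<longleftrightarrow> f) \<and> (a \<longleftrightarrow> g)"
proof -
  interpret finite_moment F \<alpha>
    using assms by unfold_locales
  \<comment> \<open>\<open>T\<close>, used with index \<open>\<theta> - \<alpha>\<close>, links (a),
    (b) and (d); \<open>V\<close>, used with index \<open>\<theta>\<close>, brings in (f).\<close>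
  interpret T: tail_integral "tail F" "W_bar F \<alpha>" \<alpha>
    by (rule W_bar_tail_integral)
  interpret V: tail_integral U "\<lambda>x. x powr (- \<alpha>) * W_bar F \<alpha> x" "- \<alpha>"
    by (rule W_bar_powr_tail_integral)
  let ?W = "\<lambda>x. W_bar F \<alpha> x / (x powr \<alpha> * tail F x)"
  let ?C = "\<lambda>x. x powr (- \<alpha>) * m - G_bar F \<alpha> x"
  let ?P = "\<forall>\<^sub>F x in at_top. tail F x > 0"
  have \<theta>: "\<theta> \<noteq> 0" "\<theta> - \<alpha> \<noteq> 0"
    using assms by auto
  have ab: "tail F \<in> RV (- \<theta>) \<longleftrightarrow> W_bar F \<alpha> \<in> RV (\<alpha> - \<theta>)"
    using T.h_RV_iff_K_RV[OF \<theta>(2)] by simp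
  have bd: "W_bar F \<alpha> \<in> RV (\<alpha> - \<theta>) \<longleftrightarrow> ?P \<and> (?W \<longlongrightarrow> 1 / (\<theta> - \<alpha>)) at_top"
    using T.K_RV_iff_ratio[OF \<theta>(2)] by simp
  have bc: "?C \<in> RV (- \<theta>) \<longleftrightarrow> W_bar F \<alpha> \<in> RV (\<alpha> - \<theta>)"
    using RV_shift_iff[of \<alpha> ?C "- \<alpha>" "W_bar F \<alpha>" "\<alpha> - \<theta>"] G_bar_eq alpha by simp
  have bv: "(\<lambda>x. x powr (- \<alpha>) * W_bar F \<alpha> x) \<in> RV (- \<theta>) \<longleftrightarrow> W_bar F \<alpha> \<in> RV (\<alpha> - \<theta>)"
    using RV_shift_iff[of 1 "\<lambda>x. x powr (- \<alpha>) * W_bar F \<alpha> x" "- \<alpha>" "W_bar F \<alpha>" "\<alpha> - \<theta>"] by simp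
  have fv: "U \<in> RV (\<alpha> - \<theta>) \<longleftrightarrow> (\<lambda>x. x powr (- \<alpha>) * W_bar F \<alpha> x) \<in> RV (- \<theta>)"
    using V.h_RV_iff_K_RV[OF \<theta>(1)] by (simp add: add.commute)
  \<comment> \<open>Where the tail is positive, the ratios in (e) and (g) are
    \<open>\<alpha> * ?W x\<close> and \<open>\<alpha> * ?W x + 1\<close>. An affine map of nonzero
    slope preserves and reflects convergence.\<close>
  have affine: "(f \<longlongrightarrow> p * (1 / (\<theta> - \<alpha>)) + q) at_top \<longleftrightarrow> (?W \<longlongrightarrow> 1 / (\<theta> - \<alpha>)) at_top"
    if ?P "p \<noteq> 0" and f: "\<And>x. 0 < x \<Longrightarrow> 0 < tail F x \<Longrightarrow> f x = p * ?W x + q" for f p q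
  proof -
    have "(f \<longlongrightarrow> p * (1 / (\<theta> - \<alpha>)) + q) at_top \<longleftrightarrow> ((\<lambda>x. p * ?W x + q) \<longlongrightarrow> p * (1 / (\<theta> - \<alpha>)) + q) at_top"
      by (intro filterlim_cong refl) (use \<open>?P\<close> eventually_gt_at_top[of 0] in eventually_elim, rule f)
    also have "\<dots> \<longleftrightarrow> (?W \<longlongrightarrow> 1 / (\<theta> - \<alpha>)) at_top"
    proof
      assume "((\<lambda>x. p * ?W x + q) \<longlongrightarrow> p * (1 / (\<theta> - \<alpha>)) + q) at_top"
      from tendsto_divide[OF tendsto_diff[OF this tendsto_const[of q]] tendsto_const[of p] \<open>p \<noteq> 0\<close>]
      show "(?W \<longlongrightarrow> 1 / (\<theta> - \<alpha>)) at_top"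
        using \<open>p \<noteq> 0\<close> by simp
    qed (rule tendsto_add[OF tendsto_mult[OF tendsto_const] tendsto_const])
    finally show ?thesis .
  qed
  have "?C x / tail F x = \<alpha> * ?W x + 0" if "0 < x" "0 < tail F x" for x
    unfolding G_bar_eq[OF that(1)] using that by (simp add: powr_minus field_simps)
  then have ed: "((\<lambda>x. ?C x / tail F x) \<longlongrightarrow> \<alpha> / (\<theta> - \<alpha>)) at_top
      \<longleftrightarrow> (?W \<longlongrightarrow> 1 / (\<theta> - \<alpha>)) at_top" if ?P
    using affine[OF that, of \<alpha> "\<lambda>x. ?C x / tail F x" 0] alpha by simp
  have "\<theta> / (\<theta> - \<alpha>) = \<alpha> * (1 / (\<theta> - \<alpha>)) + 1"
    using \<theta>(2) by (simp add: field_simps)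
  moreover have "U x / (x powr \<alpha> * tail F x) = \<alpha> * ?W x + 1" if "0 < x" "0 < tail F x" for x
    using that alpha by (simp add: W_bar_eq field_simps)
  ultimately have gd: "((\<lambda>x. U x / (x powr \<alpha> * tail F x)) \<longlongrightarrow> \<theta> / (\<theta> - \<alpha>)) at_top
      \<longleftrightarrow> (?W \<longlongrightarrow> 1 / (\<theta> - \<alpha>)) at_top" if ?P
    using affine[OF that, of \<alpha> "\<lambda>x. U x / (x powr \<alpha> * tail F x)" 1] alpha by simp
  show ?thesis
    unfolding Let_def using ab bd bc bv fv ed gd by blast
qed

end
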